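(* Let $b$ be a prime, let $m,\alpha,d\in\mathbb{N}$ with $\min(\alpha,d)>1$, and let $\gamma_v\ge0$ be real weights given for all finite $v\subset\mathbb{N}$. For each dimension $s\in\mathbb{N}$, suppose $\boldsymbol{q}=(q_1,\ldots,q_{ds})$ and $p$ are found by the component-by-component algorithm with weights $\boldsymbol{\gamma}=(\gamma_v)_{v\subseteq\{1:s\}}$: $p\in\mathbb{F}_b[x]$ is irreducible with $\deg(p)=m$, $q_1=1$, and for $\tau=2,\ldots,ds$ successively, $q_\tau$ minimizes $B_{\alpha,d,\boldsymbol{\gamma},(1)}((q_1,\ldots,q_{\tau-1},\tilde q_\tau),p)$ over $\tilde q_\tau\in\mathcal{R}_m$. Define, for $q\ge0$ and $1/\min(\alpha,d)<\lambda\le1$, $$A_{\lambda,q}:=\limsup_{s\to\infty}\left[\frac1{s^q}\sum_{\emptyset\ne v\subseteq\{1:s\}}\tilde\gamma_v^\lambda G_{\alpha,d,\lambda,d,(1)}^{|v|}\right].$$ 1. Assume $A_{\lambda,0}<\infty$ for some $1/\min(\alpha,d)<\lambda\le1$. Then the worst-case error $e(\mathcal{D}_d(P_{b^m,ds}(\boldsymbol{q},p)),\mathcal{W}_{s,\alpha,\boldsymbol{\gamma}})$ is bounded independently of the dimension, i.e. it is at most a constant not depending on $s$. 2. Assume $A_{\lambda,q}<\infty$ for some $1/\min(\alpha,d)<\lambda\le1$ and $q>0$. Then the worst-case error $e(\mathcal{D}_d(P_{b^m,ds}(\boldsymbol{q},p)),\mathcal{W}_{s,\alpha,\boldsymbol{\gamma}})$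 satisfies a bound which depends only polynomially on the dimension, i.e. it is at most $Cs^{\beta}$ for all $s$, with constants $C,\beta\ge 0$ not depending on $s$.
   Context: $\mathbb{N}$ is the set of positive integers, $\mathbb{N}_0=\mathbb{N}\cup\{0\}$, $\{a:c\}=\{a,\ldots,c\}$ (empty if $c<a$); $\mathbb{F}_b$ is the field with $b$ elements, identified with $\{0,\ldots,b-1\}$; $\mathcal{R}_m=\{q\in\mathbb{F}_b[x]:\deg(q)<m,\ q\ne0\}$. All $b$-adic expansions of reals in $[0,1)$ are the unique ones with infinitely many digits different from $b-1$. A non-negative integer $n=\nu_0+\nu_1b+\cdots$ is identified with $n(x)=\nu_0+\nu_1x+\cdots\in\mathbb{F}_b[x]$. Constants: $\tilde\gamma_v=\gamma_vb^{\alpha(2d-1)|v|/2}$ and $$G_{\alpha,d,\lambda,d,(1)}=-1+(1+\tilde G_{\alpha,d,\lambda,(1)})^d,\quad\tilde G_{\alpha,d,\lambda,(1)}=\frac1{b^{\alpha\lambda/2}}\max\left\{\left(\frac{b-1}{b^{\min(\alpha,d)}-b}\right)^\lambda,\frac{b-1}{b^{\lambda\min(\alpha,d)}-b}\right\}.$$ Point sets: $v_m(\sum_{l=w}^\infty t_lx^{-l})=\sum_{l=\max(1,w)}^mt_lb^{-l}$ for Laurent series over $\mathbb{F}_b$; $P_{b^m,ds}(\boldsymbol{q},p)$ consists of $\boldsymbol{z}_n=(z_{n,1},\ldots,z_{n,ds})$, $z_{n,j}=v_m(n(x)q_j(x)/p(x))$, $0\le n<b^m$. For $y_r=\sum_{a\ge1}y_{r,a}b^{-a}\in[0,1)$,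 $\mathcal{D}_d(y_1,\ldots,y_d)=\sum_{a=1}^\infty\sum_{r=1}^dy_{r,a}b^{-r-(a-1)d}$, applied to vectors in $[0,1)^{ds}$ on each of the $s$ consecutive blocks of $d$ components; $\mathcal{D}_d(P_{b^m,ds}(\boldsymbol{q},p))$ consists of the points $\mathcal{D}_d(\boldsymbol{z}_n)\in[0,1)^s$, $0\le n<b^m$. Quality criterion: for $z\in[0,1)$, $$\phi_{\alpha,d,(1)}(z)=\frac{b-1-b^{(\min(\alpha,d)-1)\lfloor\log_bz\rfloor}(b^{\min(\alpha,d)}-1)}{b^{(\alpha+2)/2}(b^{\min(\alpha,d)-1}-1)},$$ with $b^{\lfloor\log_b0\rfloor}=0$. For $1\le\tau\le ds$, $j_0=\lceil\tau/d\rceil$, $d_0=\tau-(j_0-1)d$, $\boldsymbol{q}_\tau=(q_1,\ldots,q_\tau)$ and $\Phi_{n,j}=-1+\prod_{l=1}^d(1+\phi_{\alpha,d,(1)}(z_{n,(j-1)d+l}))$, $$B_{\alpha,d,\boldsymbol{\gamma},(1)}(\boldsymbol{q}_\tau,p)=\frac1{b^m}\sum_{n=0}^{b^m-1}\sum_{\emptyset\ne v\subseteq\{1:j_0-1\}}\tilde\gamma_v\prod_{j\in v}\Phi_{n,j}+\frac1{b^m}\sum_{n=0}^{b^m-1}\sum_{v\subseteq\{1:j_0-1\}}\tilde\gamma_{v\cup\{j_0\}}\Big(\prod_{j\in v}\Phi_{n,j}\Big)\left[-1+\prod_{l=1}^{d_0}\left(1+\phi_{\alpha,d,(1)}(z_{n,(j_0-1)d+l})\right)\right].$$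 Walsh functions: with $\omega_b=e^{2\pi\mathrm{i}/b}$, $\mathrm{wal}_k(x)=\omega_b^{x_1\kappa_0+\cdots+x_a\kappa_{a-1}}$ for $k=\kappa_0+\cdots+\kappa_{a-1}b^{a-1}$, $x=\sum_ix_ib^{-i}$; $\mathrm{wal}_{\boldsymbol{k}}(\boldsymbol{x})=\prod_j\mathrm{wal}_{k_j}(x_j)$; $\hat f(\boldsymbol{l})=\int_{[0,1)^s}f(\boldsymbol{x})\overline{\mathrm{wal}_{\boldsymbol{l}}(\boldsymbol{x})}\,\mathrm{d}\boldsymbol{x}$. For $k=\kappa_1b^{a_1-1}+\cdots+\kappa_\nu b^{a_\nu-1}\in\mathbb{N}$ with $1\le a_\nu<\cdots<a_1$, $\kappa_i\in\{1,\ldots,b-1\}$, $\mu_\alpha(k)=a_1+\cdots+a_{\min(\nu,\alpha)}$ and $r_\alpha(k)=b^{-\mu_\alpha(k)}$; $r_\alpha(\boldsymbol{k}_v)=\prod_{j\in v}r_\alpha(k_j)$. Weighted Walsh space: $\mathcal{W}_{s,\alpha,\boldsymbol{\gamma}}$ consists of functions $f:[0,1)^s\to\mathbb{R}$ in $L_2([0,1)^s)$ with finite norm $$\|f\|_{\mathcal{W}_{s,\alpha,\boldsymbol{\gamma}}}=\max_{v\subseteq\{1:s\},\,\gamma_v\ne0}\gamma_v^{-1}\sup_{\boldsymbol{l}_v\in\mathbb{N}^{|v|}}\frac{|\hat f(\boldsymbol{l}_v,\boldsymbol{0})|}{r_\alpha(\boldsymbol{l}_v)},$$ where $(\boldsymbol{l}_v,\boldsymbol{0})\in\mathbb{N}_0^s$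 has components $0$ outside $v$. Conventions: the Walsh series of every $f$ in the space converges absolutely to $f(\boldsymbol{x})$ at every point, and $\hat f(\boldsymbol{l}_v,\boldsymbol{0})=0$ for all $\boldsymbol{l}_v\in\mathbb{N}^{|v|}$ whenever $\gamma_v=0$. Worst-case error: for $P=\{\boldsymbol{x}_0,\ldots,\boldsymbol{x}_{N-1}\}$, $e(P,\mathcal{W}_{s,\alpha,\boldsymbol{\gamma}})=\sup\left|\frac1N\sum_{n=0}^{N-1}f(\boldsymbol{x}_n)-\int_{[0,1)^s}f(\boldsymbol{x})\,\mathrm{d}\boldsymbol{x}\right|$ over $f\in\mathcal{W}_{s,\alpha,\boldsymbol{\gamma}}$ with $\|f\|_{\mathcal{W}_{s,\alpha,\boldsymbol{\gamma}}}\le1$. *)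

theory Defs
  imports
    "HOL-Analysis.Analysis"
    "HOL-Computational_Algebra.Formal_Laurent_Series"
    "Berlekamp_Zassenhaus.Finite_Field"
begin

text \<open>
  The field with \<open>b\<close> elements, \<open>b\<close> prime, is \<open>'b mod_ring\<close> with \<open>'b :: prime_card\<close> and
  \<open>b = CARD('b)\<close>; its identification with \<open>{0, ..., b - 1}\<close> is given by \<^const>\<open>to_int_mod_ring\<close>
  in one direction and by \<^const>\<open>of_nat\<close> in the other.
  Coordinates are numbered from 1. A vector is a function on \<open>nat\<close>, so that its
  dimension can vary within a formula; points of \<open>[0,1)\<^sup>s\<close> and Walsh indices are extensional
  outside \<open>{1..s}\<close>.
\<close>

definition nat_digit :: "nat \<Rightarrow> nat \<Rightarrow> nat \<Rightarrow> nat" where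
  "nat_digit b k i = k div b ^ i mod b"

text \<open>
  The coefficient of \<open>b\<^sup>-\<^sup>a\<close> (\<open>a \<ge> 1\<close>) in the expansion of \<open>y \<in> [0,1)\<close>. Truncation yields the
  expansion that has infinitely many digits different from \<open>b - 1\<close>.
\<close>

definition real_digit :: "nat \<Rightarrow> real \<Rightarrow> nat \<Rightarrow> nat" where
  "real_digit b y a = nat (\<lfloor>real b ^ a * y\<rfloor> mod int b)"

text \<open>The sum may stop at \<open>i = n\<close> because the later digits of \<open>n\<close> vanish.\<close>

definition poly_of_nat :: "nat \<Rightarrow> 'b::prime_card mod_ring poly" where
  "poly_of_nat n = (\<Sum>i\<le>n. Polynomial.monom (of_nat (nat_digit CARD('b) n i)) i)"

text \<open>
  Laurent series in \<open>x\<^sup>-\<^sup>1\<close> are represented with the library's indeterminate \<^const>\<open>fls_X\<close> playing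
  the role of \<open>x\<^sup>-\<^sup>1\<close>. So \<open>x\<close> becomes \<^const>\<open>fls_X_inv\<close>, and the coefficient of \<open>x\<^sup>-\<^sup>l\<close> is the
  one with index \<open>l\<close>.
\<close>

definition laurent_of_poly :: "'a::field poly \<Rightarrow> 'a fls" where
  "laurent_of_poly g = poly (map_poly fls_const g) fls_X_inv"

definition laurent_trunc :: "nat \<Rightarrow> 'b::prime_card mod_ring fls \<Rightarrow> real" where
  "laurent_trunc m F =
     (\<Sum>l = 1..m. real_of_int (to_int_mod_ring (fls_nth F (int l))) / real CARD('b) ^ l)"

definition lattice_coord ::
  "nat \<Rightarrow> (nat \<Rightarrow> 'b::prime_card mod_ring poly) \<Rightarrow> 'b mod_ring poly \<Rightarrow> nat \<Rightarrow> nat \<Rightarrow> real" where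
  "lattice_coord m q p n j =
     laurent_trunc m
       (laurent_of_poly (poly_of_nat n) * laurent_of_poly (q j) / laurent_of_poly p)"

definition interlace :: "nat \<Rightarrow> nat \<Rightarrow> (nat \<Rightarrow> real) \<Rightarrow> real" where
  "interlace b d y =
     (\<Sum>a. \<Sum>r = 1..d. real (real_digit b (y r) (Suc a)) / real b ^ (r + a * d))"

definition interlace_vec :: "nat \<Rightarrow> nat \<Rightarrow> nat \<Rightarrow> (nat \<Rightarrow> real) \<Rightarrow> (nat \<Rightarrow> real)" where
  "interlace_vec b d s z = (\<lambda>j\<in>{1..s}. interlace b d (\<lambda>r. z ((j - 1) * d + r)))"

definition interlaced_lattice_point ::
  "nat \<Rightarrow> nat \<Rightarrow> nat \<Rightarrow> (nat \<Rightarrow> 'b::prime_card mod_ring poly) \<Rightarrow> 'b mod_ring poly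
    \<Rightarrow> nat \<Rightarrow> (nat \<Rightarrow> real)" where
  "interlaced_lattice_point m d s q p n = interlace_vec CARD('b) d s (lattice_coord m q p n)"

definition gamma_tilde ::
  "nat \<Rightarrow> nat \<Rightarrow> nat \<Rightarrow> (nat set \<Rightarrow> real) \<Rightarrow> nat set \<Rightarrow> real" where
  "gamma_tilde b \<alpha> d \<gamma> v =
     \<gamma> v * real b powr (real \<alpha> * (2 * real d - 1) * real (card v) / 2)"

definition G_tilde :: "nat \<Rightarrow> nat \<Rightarrow> nat \<Rightarrow> real \<Rightarrow> real" where
  "G_tilde b \<alpha> d lam =
     1 / real b powr (real \<alpha> * lam / 2) *
     max (((real b - 1) / (real b ^ min \<alpha> d - real b)) powr lam)
         ((real b - 1) / (real b powr (lam * real (min \<alpha> d)) - real b))"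

definition G_const :: "nat \<Rightarrow> nat \<Rightarrow> nat \<Rightarrow> real \<Rightarrow> real" where
  "G_const b \<alpha> d lam = - 1 + (1 + G_tilde b \<alpha> d lam) ^ d"

text \<open>\<open>b\<close> to the power \<open>\<lfloor>log\<^sub>b z\<rfloor>\<close>, with the convention that this is \<open>0\<close> for \<open>z = 0\<close>.\<close>

definition floor_power :: "nat \<Rightarrow> real \<Rightarrow> real" where
  "floor_power b z = (if z = 0 then 0 else real b powi \<lfloor>log (real b) z\<rfloor>)"

definition phi :: "nat \<Rightarrow> nat \<Rightarrow> nat \<Rightarrow> real \<Rightarrow> real" where
  "phi b \<alpha> d z =
     (real b - 1 - floor_power b z ^ (min \<alpha> d - 1) * (real b ^ min \<alpha> d - 1)) /
     (real b powr ((real \<alpha> + 2) / 2) * (real b ^ (min \<alpha> d - 1) - 1))"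

text \<open>
  Only the first \<open>k\<close> of the \<open>d\<close> coordinates of block \<open>j\<close> enter; the last block considered by the
  component-by-component construction can be incomplete.
\<close>

definition block_factor ::
  "nat \<Rightarrow> nat \<Rightarrow> nat \<Rightarrow> nat \<Rightarrow> (nat \<Rightarrow> real) \<Rightarrow> nat \<Rightarrow> real" where
  "block_factor b \<alpha> d k z j = - 1 + (\<Prod>l = 1..k. 1 + phi b \<alpha> d (z ((j - 1) * d + l)))"

definition criterion ::
  "nat \<Rightarrow> nat \<Rightarrow> (nat set \<Rightarrow> real) \<Rightarrow> nat \<Rightarrow> (nat \<Rightarrow> 'b::prime_card mod_ring poly)
    \<Rightarrow> 'b mod_ring poly \<Rightarrow> nat \<Rightarrow> real" where
  "criterion \<alpha> d \<gamma> m q p \<tau> =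
    (let b = CARD('b);
         j0 = nat \<lceil>real \<tau> / real d\<rceil>;
         d0 = \<tau> - (j0 - 1) * d;
         z = lattice_coord m q p
     in 1 / real b ^ m * (\<Sum>n<b ^ m. \<Sum>v \<in> Pow {1..j0 - 1} - {{}}.
           gamma_tilde b \<alpha> d \<gamma> v * (\<Prod>j\<in>v. block_factor b \<alpha> d d (z n) j))
      + 1 / real b ^ m * (\<Sum>n<b ^ m. \<Sum>v \<in> Pow {1..j0 - 1}.
           gamma_tilde b \<alpha> d \<gamma> (v \<union> {j0}) * (\<Prod>j\<in>v. block_factor b \<alpha> d d (z n) j)
             * block_factor b \<alpha> d d0 (z n) j0))"

definition cbc_polys :: "nat \<Rightarrow> 'b::prime_card mod_ring poly set" where
  "cbc_polys m = {g. Polynomial.degree g < m \<and> g \<noteq> 0}"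

definition cbc_constructed ::
  "nat \<Rightarrow> nat \<Rightarrow> (nat set \<Rightarrow> real) \<Rightarrow> nat \<Rightarrow> nat \<Rightarrow> (nat \<Rightarrow> 'b::prime_card mod_ring poly)
    \<Rightarrow> 'b mod_ring poly \<Rightarrow> bool" where
  "cbc_constructed \<alpha> d \<gamma> m s q p \<longleftrightarrow>
     Factorial_Ring.irreducible p \<and> Polynomial.degree p = m \<and> q 1 = 1 \<and>
     (\<forall>\<tau>\<in>{2..d * s}.
        is_arg_min (\<lambda>g. criterion \<alpha> d \<gamma> m (q(\<tau> := g)) p \<tau>) (\<lambda>g. g \<in> cbc_polys m) (q \<tau>))"

definition unit_cube :: "nat \<Rightarrow> (nat \<Rightarrow> real) measure" where
  "unit_cube s = PiM {1..s} (\<lambda>_. restrict_space lborel {0..<1})"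

definition walsh :: "nat \<Rightarrow> nat \<Rightarrow> real \<Rightarrow> complex" where
  "walsh b k x =
     exp (2 * of_real pi * \<i> / of_nat b) ^ (\<Sum>i\<le>k. real_digit b x (Suc i) * nat_digit b k i)"

definition walsh_vec :: "nat \<Rightarrow> nat \<Rightarrow> (nat \<Rightarrow> nat) \<Rightarrow> (nat \<Rightarrow> real) \<Rightarrow> complex" where
  "walsh_vec b s k x = (\<Prod>j\<in>{1..s}. walsh b (k j) (x j))"

definition walsh_coeff ::
  "nat \<Rightarrow> nat \<Rightarrow> ((nat \<Rightarrow> real) \<Rightarrow> real) \<Rightarrow> (nat \<Rightarrow> nat) \<Rightarrow> complex" where
  "walsh_coeff b s f l = (LINT x|unit_cube s. of_real (f x) * cnj (walsh_vec b s l x))"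

text \<open>The nonzero digits of \<open>k\<close> sit at the positions \<open>a - 1\<close>, listed here in decreasing order.\<close>

definition mu :: "nat \<Rightarrow> nat \<Rightarrow> nat \<Rightarrow> nat" where
  "mu b \<alpha> k =
     sum_list (take \<alpha> (rev (sorted_list_of_set {a. 1 \<le> a \<and> nat_digit b k (a - 1) \<noteq> 0})))"

definition r_weight :: "nat \<Rightarrow> nat \<Rightarrow> nat \<Rightarrow> real" where
  "r_weight b \<alpha> k = 1 / real b ^ mu b \<alpha> k"

definition zero_extend :: "nat \<Rightarrow> nat set \<Rightarrow> (nat \<Rightarrow> nat) \<Rightarrow> (nat \<Rightarrow> nat)" where
  "zero_extend s v l = (\<lambda>j\<in>{1..s}. if j \<in> v then l j else 0)"

text \<open>
  The supremum over the finitely many \<open>v\<close> is a maximum; it is \<open>0\<close> if \<open>\<gamma>\<close> vanishes on all of them.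
\<close>

definition walsh_norm ::
  "nat \<Rightarrow> nat \<Rightarrow> nat \<Rightarrow> (nat set \<Rightarrow> real) \<Rightarrow> ((nat \<Rightarrow> real) \<Rightarrow> real) \<Rightarrow> ennreal" where
  "walsh_norm b s \<alpha> \<gamma> f =
     (SUP v\<in>{v. v \<subseteq> {1..s} \<and> \<gamma> v \<noteq> 0}. SUP l\<in>(v \<rightarrow>\<^sub>E {1..}).
        ennreal (inverse (\<gamma> v) *
          (cmod (walsh_coeff b s f (zero_extend s v l)) / (\<Prod>j\<in>v. r_weight b \<alpha> (l j)))))"

definition walsh_space ::
  "nat \<Rightarrow> nat \<Rightarrow> nat \<Rightarrow> (nat set \<Rightarrow> real) \<Rightarrow> ((nat \<Rightarrow> real) \<Rightarrow> real) set" where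
  "walsh_space b s \<alpha> \<gamma> =
     {f. f \<in> borel_measurable (unit_cube s) \<and>
         integrable (unit_cube s) (\<lambda>x. (f x)\<^sup>2) \<and>
         walsh_norm b s \<alpha> \<gamma> f < \<infinity> \<and>
         (\<forall>x \<in> {1..s} \<rightarrow>\<^sub>E {0..<1}.
            (\<lambda>l. norm (walsh_coeff b s f l * walsh_vec b s l x)) summable_on ({1..s} \<rightarrow>\<^sub>E UNIV) \<and>
            (\<Sum>\<^sub>\<infinity>l \<in> {1..s} \<rightarrow>\<^sub>E UNIV. walsh_coeff b s f l * walsh_vec b s l x) = of_real (f x)) \<and>
         (\<forall>v \<subseteq> {1..s}. \<gamma> v = 0 \<longrightarrow>
            (\<forall>l \<in> v \<rightarrow>\<^sub>E {1..}. walsh_coeff b s f (zero_extend s v l) = 0))}"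

definition worst_case_error ::
  "nat \<Rightarrow> nat \<Rightarrow> nat \<Rightarrow> (nat set \<Rightarrow> real) \<Rightarrow> nat \<Rightarrow> (nat \<Rightarrow> nat \<Rightarrow> real) \<Rightarrow> ennreal" where
  "worst_case_error b s \<alpha> \<gamma> N x =
     (SUP f\<in>{f \<in> walsh_space b s \<alpha> \<gamma>. walsh_norm b s \<alpha> \<gamma> f \<le> 1}.
        ennreal \<bar>1 / real N * (\<Sum>n<N. f (x n)) - (LINT y|unit_cube s. f y)\<bar>)"

definition A_limsup ::
  "nat \<Rightarrow> nat \<Rightarrow> nat \<Rightarrow> (nat set \<Rightarrow> real) \<Rightarrow> real \<Rightarrow> real \<Rightarrow> ereal" where
  "A_limsup b \<alpha> d \<gamma> lam q =
     limsup (\<lambda>s. ereal (1 / real s powr q *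
       (\<Sum>v \<in> Pow {1..s} - {{}}. gamma_tilde b \<alpha> d \<gamma> v powr lam * G_const b \<alpha> d lam ^ card v)))"

end

theory Submission
  imports Defs
begin

text \<open>
  The claim already follows from an error bound, uniform in \<open>m\<close>, that holds
  for every point set in the cube, however the lattice is constructed. Walsh functions have modulus 1,
  so the integration error of \<open>f\<close> is at most the sum of the moduli of its Walsh coefficients at nonzero
  indices. In the unit ball this is at most the sum of \<open>\<gamma> v * R ^ card v\<close> over nonempty \<open>v\<close>, where
  \<open>R\<close> is the sum of \<open>r_weight b \<alpha> k\<close> over \<open>k \<ge> 1\<close>. Splitting off the leading digit of \<open>k\<close>
  shows \<open>R \<le> 1 + 1 / b \<le> 2\<close> for \<open>\<alpha> \<ge> 2\<close>. On the other hand the factor \<open>b\<close> to the power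
  \<open>\<alpha> * (2 * d - 1) / 2\<close> in \<open>gamma_tilde\<close> is so large that its \<open>lam\<close>-th power times \<open>G_const\<close> is at
  least \<open>2 powr lam\<close>. Since \<open>lam \<le> 1\<close>, Jensen's inequality for sums then bounds the error by the
  \<open>1 / lam\<close>-th power of the sum occurring in \<open>A_limsup\<close>.
\<close>

section \<open>Base-\<open>b\<close> digits of integers and the sum of the weights
  \<open>r_weight\<close>\<close>

lemma nat_digit_0 [simp]: "nat_digit b 0 i = 0"
  by (simp add: nat_digit_def)

lemma nat_digit_eq_0:
  assumes "k < b ^ n" "n \<le> i" "b > 0"
  shows "nat_digit b k i = 0"
proof -
  have "b ^ n \<le> b ^ i"
    using assms by (intro power_increasing) auto
  then show ?thesis
    using assms by (simp add: nat_digit_def)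
qed

lemma nat_digit_leading:
  assumes "k < b ^ n" "c < b"
  shows "nat_digit b (c * b ^ n + k) i = (if i = n then c else nat_digit b k i)"
proof (cases "i < n")
  case True
  then obtain e where n: "n = i + Suc e"
    using less_imp_Suc_add by auto
  \<comment> \<open>The part \<open>c * b ^ n\<close> is a multiple of \<open>b ^ Suc i\<close>, so
    after division by \<open>b ^ i\<close> it vanishes modulo \<open>b\<close>.\<close>
  have "c * b ^ n + k = k + (c * b ^ Suc e) * b ^ i"
    by (simp add: n power_add)
  also have "\<dots> div b ^ i = c * b ^ Suc e + k div b ^ i"
    using assms by (intro div_mult_self1) auto
  finally have "(c * b ^ n + k) div b ^ i = c * b ^ Suc e + k div b ^ i" .
  then show ?thesis
    using True by (simp add: nat_digit_def mult.left_commute[of c b])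
next
  case False
  have "b > 0" using assms by auto
  show ?thesis
  proof (cases "i = n")
    case True
    then show ?thesis
      using assms \<open>b > 0\<close> by (simp add: nat_digit_def)
  next
    case neq: False
    have "c * b ^ n + k < Suc c * b ^ n"
      using assms by simp
    also have "\<dots> \<le> b ^ Suc n"
      using assms by (simp add: Suc_leI del: mult_Suc)
    finally have "nat_digit b (c * b ^ n + k) i = 0"
      using neq False \<open>b > 0\<close> by (intro nat_digit_eq_0[of _ _ "Suc n"]) auto
    moreover have "nat_digit b k i = 0"
      using assms False \<open>b > 0\<close> by (intro nat_digit_eq_0[of _ _ n]) auto
    ultimately show ?thesis
      using neq by simp
  qed
qed

lemma mu_0 [simp]: "mu b \<alpha> 0 = 0"
  by (simp add: mu_def)

text \<open>The new digit lies above all digits of \<open>k\<close> and heads the decreasing list of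
  positions. It takes one of the \<open>Suc \<alpha>\<close> places in \<open>take\<close> and
  leaves \<open>\<alpha>\<close> of them for \<open>k\<close>.\<close>

lemma mu_leading:
  assumes "k < b ^ n" "0 < c" "c < b"
  shows "mu b (Suc \<alpha>) (c * b ^ n + k) = Suc n + mu b \<alpha> k"
proof -
  let ?S = "{a. 1 \<le> a \<and> nat_digit b k (a - 1) \<noteq> 0}"
  have sub: "?S \<subseteq> {1..n}"
  proof
    fix a assume a: "a \<in> ?S"
    have "\<not> n \<le> a - 1"
      using a assms nat_digit_eq_0[OF assms(1), of "a - 1"] by auto
    then show "a \<in> {1..n}"
      using a by auto
  qed
  then have fin: "finite ?S"
    using finite_subset by blast
  have "{a. 1 \<le> a \<and> nat_digit b (c * b ^ n + k) (a - 1) \<noteq> 0} = insert (Suc n) ?S"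
    using assms by (auto simp: nat_digit_leading split: if_splits)
  \<comment> \<open>\<open>Suc n\<close> exceeds every element of \<open>?S\<close>, so it comes
    last here and first after \<open>rev\<close>.\<close>
  moreover have "sorted_list_of_set (insert (Suc n) ?S) = sorted_list_of_set ?S @ [Suc n]"
  proof -
    have "sorted (sorted_list_of_set ?S @ [Suc n])" "distinct (sorted_list_of_set ?S @ [Suc n])"
      using sub fin by (force simp: sorted_append)+
    from sorted_list_of_set.idem_if_sorted_distinct[OF this] show ?thesis
      using fin by simp
  qed
  ultimately show ?thesis
    by (simp add: mu_def)
qed

lemma r_weight_0 [simp]: "r_weight b \<alpha> 0 = 1"
  by (simp add: r_weight_def)

lemma r_weight_nonneg: "r_weight b \<alpha> k \<ge> 0"
  by (simp add: r_weight_def)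

lemma r_weight_le_1: "b > 0 \<Longrightarrow> r_weight b \<alpha> k \<le> 1"
  by (simp add: r_weight_def)

text \<open>Group the indices below \<open>b ^ Suc n\<close> by their top digit \<open>c\<close>.
  The group \<open>c = 0\<close> is the previous sum; by \<open>mu_leading\<close> each of the
  \<open>b - 1\<close> others contributes a factor \<open>1 / b ^ Suc n\<close> and lowers the
  smoothness by one.\<close>

lemma sum_r_weight_Suc:
  assumes "b > 0"
  shows "(\<Sum>k<b ^ Suc n. r_weight b (Suc \<alpha>) k) =
    (\<Sum>k<b ^ n. r_weight b (Suc \<alpha>) k) + (real b - 1) / real b ^ Suc n * (\<Sum>k<b ^ n. r_weight b \<alpha> k)"
proof -
  have "(\<Sum>k<b ^ Suc n. r_weight b (Suc \<alpha>) k) =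
      (\<Sum>c<b. \<Sum>k<b ^ n. r_weight b (Suc \<alpha>) (c * b ^ n + k))"
    using sum.nat_group[of "r_weight b (Suc \<alpha>)" "b ^ n" b]
    by (simp add: sum.atLeastLessThan_shift_0 atLeast0LessThan)
  also have "\<dots> = (\<Sum>k<b ^ n. r_weight b (Suc \<alpha>) k) +
      (\<Sum>c\<in>{1..<b}. \<Sum>k<b ^ n. r_weight b (Suc \<alpha>) (c * b ^ n + k))"
    using assms by (simp add: lessThan_atLeast0 sum.atLeast_Suc_lessThan)
  also have "(\<Sum>c\<in>{1..<b}. \<Sum>k<b ^ n. r_weight b (Suc \<alpha>) (c * b ^ n + k)) =
      (\<Sum>c\<in>{1..<b}. 1 / real b ^ Suc n * (\<Sum>k<b ^ n. r_weight b \<alpha> k))"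
    unfolding sum_distrib_left
    by (intro sum.cong refl) (simp add: r_weight_def mu_leading power_add)
  also have "\<dots> = (real b - 1) / real b ^ Suc n * (\<Sum>k<b ^ n. r_weight b \<alpha> k)"
    using assms by (simp add: of_nat_diff)
  finally show ?thesis .
qed

text \<open>With the trivial bound 1 for the weights of lower smoothness, each step of the recursion
  adds at most \<open>(b - 1) / b\<close>. This linear growth is mild enough to be summed against
  \<open>1 / b ^ n\<close> one smoothness level higher.\<close>

lemma sum_r_weight_le_linear:
  assumes "b > 0" "\<alpha> \<ge> 1"
  shows "(\<Sum>k<b ^ n. r_weight b \<alpha> k) \<le> 1 + n * (real b - 1) / real b"
proof -
  obtain \<alpha>' where \<alpha>: "\<alpha> = Suc \<alpha>'"
    using assms by (cases \<alpha>) auto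
  show ?thesis unfolding \<alpha>
  proof (induction n)
    case (Suc n)
    have "(\<Sum>k<b ^ n. r_weight b \<alpha>' k) \<le> (\<Sum>k<b ^ n. 1)"
      using assms by (intro sum_mono r_weight_le_1)
    then have "(real b - 1) / real b ^ Suc n * (\<Sum>k<b ^ n. r_weight b \<alpha>' k)
        \<le> (real b - 1) / real b ^ Suc n * real b ^ n"
      using assms by (intro mult_left_mono) auto
    also have "\<dots> = (real b - 1) / real b"
      using assms by simp
    finally show ?case
      using Suc unfolding sum_r_weight_Suc[OF assms(1)] by (simp add: add_divide_distrib distrib_right)
  qed auto
qed

lemma sum_r_weight_le_2:
  assumes "b \<ge> 2" "\<alpha> \<ge> 2"
  shows "(\<Sum>k = 1..K. r_weight b \<alpha> k) \<le> 2"
proof -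
  obtain \<alpha>' where \<alpha>: "\<alpha> = Suc \<alpha>'" "\<alpha>' \<ge> 1"
    using assms by (cases \<alpha>) auto
  \<comment> \<open>The right-hand side solves the recursion of \<open>sum_r_weight_Suc\<close> with the linear bound inserted.\<close>
  have closed: "(\<Sum>k<b ^ n. r_weight b \<alpha> k) \<le>
      2 + 1 / real b - (1 + 1 / real b + n * (real b - 1) / real b) / real b ^ n" for n
  proof (induction n)
    case (Suc n)
    have "(\<Sum>k<b ^ Suc n. r_weight b \<alpha> k) =
        (\<Sum>k<b ^ n. r_weight b \<alpha> k) + (real b - 1) / real b ^ Suc n * (\<Sum>k<b ^ n. r_weight b \<alpha>' k)"
      unfolding \<alpha> using assms by (intro sum_r_weight_Suc) auto
    also have "\<dots> \<le> 2 + 1 / real b - (1 + 1 / real b + n * (real b - 1) / real b) / real b ^ n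
        + (real b - 1) / real b ^ Suc n * (1 + n * (real b - 1) / real b)"
      using assms \<alpha> by (intro add_mono Suc.IH mult_left_mono sum_r_weight_le_linear) auto
    also have "\<dots> = 2 + 1 / real b - (1 + 1 / real b + Suc n * (real b - 1) / real b) / real b ^ Suc n"
      using assms by (simp add: divide_simps) (simp add: algebra_simps)
    finally show ?case .
  qed auto
  \<comment> \<open>The closed bound covers only full ranges \<open>k < b ^ n\<close>; the choice
    \<open>n = K\<close> makes such a range contain \<open>{1..K}\<close>.\<close>
  have "K < 2 ^ K"
    by (rule less_exp)
  also have "(2::nat) ^ K \<le> b ^ K"
    using assms by (intro power_mono) auto
  finally have K: "{1..K} \<subseteq> {..<b ^ K} - {0}"
    by auto
  have "(\<Sum>k = 1..K. r_weight b \<alpha> k) \<le> (\<Sum>k\<in>{..<b ^ K} - {0}. r_weight b \<alpha> k)"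
    using K by (intro sum_mono2) (auto simp: r_weight_nonneg)
  also have "\<dots> = (\<Sum>k<b ^ K. r_weight b \<alpha> k) - 1"
    using assms by (subst sum_diff1) auto
  also have "\<dots> \<le> 1 + 1 / real b"
  proof -
    have "(1 + 1 / real b + K * (real b - 1) / real b) / real b ^ K \<ge> 0"
      using assms by (intro divide_nonneg_nonneg add_nonneg_nonneg mult_nonneg_nonneg) auto
    then show ?thesis
      using closed[of K] by linarith
  qed
  also have "\<dots> \<le> 2"
    using assms by (simp add: divide_simps)
  finally show ?thesis .
qed

section \<open>Walsh coefficients and the integration error\<close>

lemma norm_walsh [simp]: "norm (walsh b k x) = 1"
  by (simp add: walsh_def norm_power norm_exp_eq_Re)

lemma norm_walsh_vec [simp]: "norm (walsh_vec b s k x) = 1"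
  by (simp add: walsh_vec_def prod_norm[symmetric])

lemma walsh_0 [simp]: "walsh b 0 x = 1"
  by (simp add: walsh_def)

lemma walsh_vec_0 [simp]: "walsh_vec b s (\<lambda>j\<in>{1..s}. 0) x = 1"
  by (simp add: walsh_vec_def)

lemma walsh_coeff_0: "walsh_coeff b s f (\<lambda>j\<in>{1..s}. 0) = of_real (LINT x|unit_cube s. f x)"
  unfolding walsh_coeff_def walsh_vec_0 by simp

text \<open>The norm only sees sets \<open>v\<close> of nonzero weight; for weight zero the
  coefficients vanish by the convention built into \<open>walsh_space\<close>.\<close>

lemma walsh_coeff_le:
  assumes b: "b > 0"
    and f: "f \<in> walsh_space b s \<alpha> \<gamma>" "walsh_norm b s \<alpha> \<gamma> f \<le> 1"
    and v: "v \<subseteq> {1..s}" "\<gamma> v \<ge> 0" "l \<in> v \<rightarrow>\<^sub>E {1..}"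
  shows "cmod (walsh_coeff b s f (zero_extend s v l)) \<le> \<gamma> v * (\<Prod>j\<in>v. r_weight b \<alpha> (l j))"
proof (cases "\<gamma> v = 0")
  case True
  then show ?thesis
    using f v by (simp add: walsh_space_def)
next
  case False
  have R: "(\<Prod>j\<in>v. r_weight b \<alpha> (l j)) > 0"
    using b by (intro prod_pos) (simp add: r_weight_def)
  have "ennreal (inverse (\<gamma> v) * (cmod (walsh_coeff b s f (zero_extend s v l)) /
      (\<Prod>j\<in>v. r_weight b \<alpha> (l j)))) \<le> walsh_norm b s \<alpha> \<gamma> f"
    unfolding walsh_norm_def using v False by (intro SUP_upper2[of v] SUP_upper2[of l]) auto
  also have "\<dots> \<le> 1" by fact
  finally show ?thesis
    using False v R by (simp add: ennreal_le_1 field_simps)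
qed

text \<open>Each nonzero index is the zero extension of its restriction to its support
  \<open>v\<close>. Grouping by \<open>v\<close> and enlarging each group to a full box lets the sum
  factor into one-dimensional sums, each at most 2.\<close>

lemma sum_walsh_coeff_le:
  assumes b: "b \<ge> 2" and \<alpha>: "\<alpha> \<ge> 2"
    and \<gamma>: "\<And>v. v \<subseteq> {1..s} \<Longrightarrow> \<gamma> v \<ge> 0"
    and f: "f \<in> walsh_space b s \<alpha> \<gamma>" "walsh_norm b s \<alpha> \<gamma> f \<le> 1"
    and F: "finite F" "F \<subseteq> ({1..s} \<rightarrow>\<^sub>E UNIV) - {\<lambda>j\<in>{1..s}. 0}"
  shows "(\<Sum>l\<in>F. cmod (walsh_coeff b s f l)) \<le> (\<Sum>v\<in>Pow {1..s} - {{}}. \<gamma> v * 2 ^ card v)"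
proof -
  \<comment> \<open>Any common bound on the components of the indices in \<open>F\<close> would do;
    it keeps the boxes finite.\<close>
  define K where "K = (\<Sum>l\<in>F. \<Sum>j\<in>{1..s}. l j)"
  have K: "l j \<le> K" if "l \<in> F" "j \<in> {1..s}" for l j
  proof -
    have "l j \<le> (\<Sum>j\<in>{1..s}. l j)"
      using that by (intro member_le_sum) auto
    also have "\<dots> \<le> K"
      unfolding K_def using that F by (intro member_le_sum) auto
    finally show ?thesis .
  qed
  let ?V = "Pow {1..s} - {{}}"
  let ?\<Sigma> = "Sigma ?V (\<lambda>v. v \<rightarrow>\<^sub>E {1..K})"
  let ?g = "\<lambda>(v, l). \<gamma> v * (\<Prod>j\<in>v. r_weight b \<alpha> (l j))"
  have finv: "finite v" if "v \<in> ?V" for v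
    using that finite_subset by blast
  have "(\<Sum>l\<in>F. cmod (walsh_coeff b s f l)) \<le> sum ?g ?\<Sigma>"
  proof (rule sum_le_included[where i = "\<lambda>(v, l). zero_extend s v l"])
    show "finite ?\<Sigma>"
      using finv by (intro finite_SigmaI finite_PiE) auto
    show "\<forall>y\<in>?\<Sigma>. 0 \<le> ?g y"
      using \<gamma> by (auto intro!: mult_nonneg_nonneg prod_nonneg r_weight_nonneg)
    show "\<forall>l\<in>F. \<exists>y\<in>?\<Sigma>. (case y of (v, l) \<Rightarrow> zero_extend s v l) = l \<and> cmod (walsh_coeff b s f l) \<le> ?g y"
    proof
      fix l assume l: "l \<in> F"
      define v where "v = {j \<in> {1..s}. l j \<noteq> 0}"
      have ext: "l \<in> {1..s} \<rightarrow>\<^sub>E UNIV" "l \<noteq> (\<lambda>j\<in>{1..s}. 0)"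
        using l F by auto
      have ext_eq: "zero_extend s v (restrict l v) = l"
        using ext(1) by (auto simp: zero_extend_def v_def fun_eq_iff restrict_def PiE_def extensional_def)
      have "v \<noteq> {}"
      proof
        assume "v = {}"
        then have "l = (\<lambda>j\<in>{1..s}. 0)"
          using ext(1) by (auto simp: v_def fun_eq_iff restrict_def PiE_def extensional_def)
        then show False using ext by simp
      qed
      moreover have "restrict l v \<in> v \<rightarrow>\<^sub>E {1..K}"
        using l K by (auto simp: v_def Suc_le_eq)
      moreover have vs: "v \<subseteq> {1..s}"
        by (auto simp: v_def)
      ultimately have "(v, restrict l v) \<in> ?\<Sigma>"
        by blast
      moreover have "cmod (walsh_coeff b s f (zero_extend s v (restrict l v)))
          \<le> \<gamma> v * (\<Prod>j\<in>v. r_weight b \<alpha> (restrict l v j))"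
        using b \<gamma>[OF vs] by (intro walsh_coeff_le[OF _ f]) (auto simp: v_def Suc_le_eq)
      ultimately show "\<exists>y\<in>?\<Sigma>. (case y of (v, l) \<Rightarrow> zero_extend s v l) = l \<and> cmod (walsh_coeff b s f l) \<le> ?g y"
        using ext_eq by (intro bexI[where x = "(v, restrict l v)"]) simp_all
    qed
  qed fact
  also have "\<dots> = (\<Sum>v\<in>?V. \<Sum>l\<in>v \<rightarrow>\<^sub>E {1..K}. \<gamma> v * (\<Prod>j\<in>v. r_weight b \<alpha> (l j)))"
    using finv by (intro sum.Sigma[symmetric]) (auto intro!: finite_PiE)
  also have "\<dots> = (\<Sum>v\<in>?V. \<gamma> v * (\<Prod>j\<in>v. \<Sum>k = 1..K. r_weight b \<alpha> k))"
    using finv by (intro sum.cong refl) (subst prod_sum_PiE, auto simp: sum_distrib_left)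
  also have "\<dots> \<le> (\<Sum>v\<in>?V. \<gamma> v * (\<Prod>j\<in>v. 2))"
    using \<gamma> b \<alpha>
    by (intro sum_mono mult_left_mono prod_mono conjI sum_nonneg sum_r_weight_le_2) (auto simp: r_weight_nonneg)
  finally show ?thesis by simp
qed

text \<open>The coefficient at index zero is the integral, so the difference is the rest of the
  Walsh series at \<open>x\<close>. Absolute convergence reduces its bound to finite partial
  sums.\<close>

lemma walsh_space_dist_integral_le:
  assumes "b \<ge> 2" "\<alpha> \<ge> 2" "\<And>v. v \<subseteq> {1..s} \<Longrightarrow> \<gamma> v \<ge> 0"
    and f: "f \<in> walsh_space b s \<alpha> \<gamma>" "walsh_norm b s \<alpha> \<gamma> f \<le> 1"
    and x: "x \<in> {1..s} \<rightarrow>\<^sub>E {0..<1}"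
  shows "\<bar>f x - (LINT y|unit_cube s. f y)\<bar> \<le> (\<Sum>v\<in>Pow {1..s} - {{}}. \<gamma> v * 2 ^ card v)"
    (is "_ \<le> ?B")
proof -
  let ?L = "{1..s} \<rightarrow>\<^sub>E (UNIV :: nat set)"
  let ?z = "\<lambda>j\<in>{1..s}. 0 :: nat"
  let ?g = "\<lambda>l. walsh_coeff b s f l * walsh_vec b s l x"
  have abs: "(\<lambda>l. norm (?g l)) summable_on ?L" and sum: "infsum ?g ?L = of_real (f x)"
    using f x by (auto simp: walsh_space_def)
  have abs': "(\<lambda>l. norm (?g l)) summable_on (?L - {?z})"
    using abs by (rule summable_on_subset_banach) auto
  have "infsum ?g ?L = infsum ?g ({?z} \<union> (?L - {?z}))"
    by (intro arg_cong[where f = "infsum ?g"]) auto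
  also have "\<dots> = ?g ?z + infsum ?g (?L - {?z})"
    using abs_summable_summable[OF abs'] by (subst infsum_Un_disjoint) auto
  finally have "infsum ?g (?L - {?z}) = of_real (f x - (LINT y|unit_cube s. f y))"
    unfolding sum walsh_coeff_0 walsh_vec_0 by simp
  then have "\<bar>f x - (LINT y|unit_cube s. f y)\<bar> = norm (infsum ?g (?L - {?z}))"
    by (simp only: norm_of_real)
  also have "\<dots> \<le> (\<Sum>\<^sub>\<infinity>l\<in>?L - {?z}. norm (?g l))"
    by (rule norm_infsum_bound[OF abs'])
  also have "\<dots> \<le> ?B"
  proof (rule infsum_le_finite_sums[OF abs'])
    fix F assume "finite F" "F \<subseteq> ?L - {?z}"
    then show "(\<Sum>l\<in>F. norm (?g l)) \<le> ?B"
      using sum_walsh_coeff_le[OF assms(1-5)] by (simp add: norm_mult)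
  qed
  finally show ?thesis .
qed

text \<open>The deviation from the integral is bounded at every single point, hence also on
  average.\<close>

lemma worst_case_error_le:
  assumes "b \<ge> 2" "\<alpha> \<ge> 2" "\<And>v. v \<subseteq> {1..s} \<Longrightarrow> \<gamma> v \<ge> 0" "N > 0"
    and x: "\<And>n. n < N \<Longrightarrow> x n \<in> {1..s} \<rightarrow>\<^sub>E {0..<1}"
  shows "worst_case_error b s \<alpha> \<gamma> N x \<le> ennreal (\<Sum>v\<in>Pow {1..s} - {{}}. \<gamma> v * 2 ^ card v)"
  unfolding worst_case_error_def
proof (rule SUP_least, rule ennreal_leI)
  fix f assume "f \<in> {f \<in> walsh_space b s \<alpha> \<gamma>. walsh_norm b s \<alpha> \<gamma> f \<le> 1}"
  then have f: "f \<in> walsh_space b s \<alpha> \<gamma>" "walsh_norm b s \<alpha> \<gamma> f \<le> 1"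
    by auto
  let ?I = "LINT y|unit_cube s. f y"
  let ?B = "\<Sum>v\<in>Pow {1..s} - {{}}. \<gamma> v * 2 ^ card v"
  have "1 / real N * (\<Sum>n<N. f (x n)) - ?I = (\<Sum>n<N. f (x n) - ?I) / real N"
    using assms by (simp add: sum_subtractf field_simps)
  also have "\<bar>\<dots>\<bar> \<le> (\<Sum>n<N. \<bar>f (x n) - ?I\<bar>) / real N"
    by (simp add: divide_right_mono)
  also have "\<dots> \<le> (\<Sum>n<N. ?B) / real N"
    using walsh_space_dist_integral_le[OF assms(1-3) f x]
    by (intro divide_right_mono sum_mono) auto
  also have "\<dots> = ?B"
    using assms by simp
  finally show "\<bar>1 / real N * (\<Sum>n<N. f (x n)) - ?I\<bar> \<le> ?B" .
qed

section \<open>Interlaced points lie in the half-open cube\<close>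

lemma real_digit_less: "b > 0 \<Longrightarrow> real_digit b y a < b"
  by (simp add: real_digit_def nat_less_iff)

lemma real_digit_eq_0:
  assumes "real b ^ a * y = of_int (int b * k)"
  shows "real_digit b y a = 0"
  unfolding real_digit_def assms floor_of_int by simp

text \<open>For \<open>l \<le> m < a\<close>, scaling \<open>b\<close> to the power
  \<open>-l\<close> by \<open>b ^ a\<close> leaves a positive power of \<open>b\<close>, so the
  scaled number is an integer multiple of \<open>b\<close>.\<close>

lemma real_digit_laurent_trunc:
  fixes F :: "'b::prime_card mod_ring fls"
  assumes "a > m"
  shows "real_digit CARD('b) (laurent_trunc m F) a = 0"
proof (rule real_digit_eq_0)
  let ?b = "CARD('b)"
  have "real ?b ^ a * (x / real ?b ^ l) = real ?b * (x * real ?b ^ (a - l - 1))"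
    if "l \<in> {1..m}" for l x
  proof -
    have "l < a"
      using that assms by simp
    then obtain e where "a = Suc (l + e)"
      using less_imp_Suc_add by blast
    then show ?thesis
      by (simp add: power_add)
  qed
  then show "real ?b ^ a * laurent_trunc m F =
      of_int (int ?b * (\<Sum>l = 1..m. to_int_mod_ring (fls_nth F (int l)) * int ?b ^ (a - l - 1)))"
    unfolding laurent_trunc_def sum_distrib_left of_int_mult of_int_sum
    by (intro sum.cong refl) simp
qed

lemma sum_top_digits:
  assumes "b > 0"
  shows "(\<Sum>r = 1..d. (real b - 1) / real b ^ r) = 1 - 1 / real b ^ d"
proof (induction d)
  case (Suc d)
  have "(\<Sum>r = 1..Suc d. (real b - 1) / real b ^ r) = 1 - 1 / real b ^ d + (real b - 1) / real b ^ Suc d"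
    using Suc by simp
  also have "\<dots> = 1 - 1 / real b ^ Suc d"
    using assms by (simp add: field_simps)
  finally show ?case .
qed simp

text \<open>Only finitely many digits can be nonzero, and even if all of these were
  \<open>b - 1\<close>, the value would be \<open>1 - 1 / b ^ (m * d)\<close>, which is strictly
  below 1.\<close>

lemma interlace_bounds:
  assumes b: "b > 0" and y: "\<And>r a. r \<in> {1..d} \<Longrightarrow> a > m \<Longrightarrow> real_digit b (y r) a = 0"
  shows "interlace b d y \<in> {0..<1}"
proof -
  \<comment> \<open>The index \<open>a\<close> starts at 0 and refers to digit \<open>Suc a\<close>,
    so the terms with \<open>a \<ge> m\<close> vanish.\<close>
  have interlace_eq: "interlace b d y = (\<Sum>a<m. \<Sum>r = 1..d. real (real_digit b (y r) (Suc a)) / real b ^ (r + a * d))"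
    unfolding interlace_def using y by (intro suminf_finite) (auto intro!: sum.neutral)
  also have "\<dots> \<le> (\<Sum>a<m. \<Sum>r = 1..d. (real b - 1) / real b ^ (r + a * d))"
  proof (intro sum_mono divide_right_mono)
    fix a r
    show "real (real_digit b (y r) (Suc a)) \<le> real b - 1"
      using real_digit_less[OF b, of "y r" "Suc a"] by linarith
  qed simp
  also have "\<dots> = 1 - 1 / real b ^ (m * d)"
  proof (induction m)
    case (Suc m)
    have "(\<Sum>r = 1..d. (real b - 1) / real b ^ (r + m * d)) =
        (\<Sum>r = 1..d. (real b - 1) / real b ^ r) / real b ^ (m * d)"
      by (simp add: power_add sum_divide_distrib)
    also have "\<dots> = (1 - 1 / real b ^ d) / real b ^ (m * d)"
      by (simp only: sum_top_digits[OF b])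
    finally have "(\<Sum>a<Suc m. \<Sum>r = 1..d. (real b - 1) / real b ^ (r + a * d)) =
        1 - 1 / real b ^ (m * d) + (1 - 1 / real b ^ d) / real b ^ (m * d)"
      unfolding sum.lessThan_Suc Suc by simp
    also have "\<dots> = 1 - 1 / real b ^ (Suc m * d)"
      using b by (simp add: power_add field_simps)
    finally show ?case .
  qed auto
  also have "\<dots> < 1"
    using b by simp
  finally have "interlace b d y < 1" .
  moreover have "interlace b d y \<ge> 0"
    unfolding interlace_eq by (intro sum_nonneg) simp
  ultimately show ?thesis
    by simp
qed

text \<open>Pointwise convergence of the Walsh series is available exactly on this set.\<close>

lemma interlaced_lattice_point_in_cube:
  fixes p :: "'b::prime_card mod_ring poly"
  shows "interlaced_lattice_point m d s q p n \<in> {1..s} \<rightarrow>\<^sub>E {0..<1}"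
proof -
  have "interlace CARD('b) d (\<lambda>r. lattice_coord m q p n (j r)) \<in> {0..<1}" for j :: "nat \<Rightarrow> nat"
    by (rule interlace_bounds[where m = m]) (auto simp: lattice_coord_def real_digit_laurent_trunc)
  then show ?thesis
    by (auto simp: interlaced_lattice_point_def interlace_vec_def)
qed

section \<open>Comparison of the weights with those in \<open>A_limsup\<close>\<close>

text \<open>The first entry of the maximum suffices: its denominator is at most
  \<open>b ^ min \<alpha> d\<close>, which \<open>b ^ (\<alpha> * (d - 1))\<close>
  dominates.\<close>

lemma G_tilde_ge:
  assumes "b \<ge> 2" "min \<alpha> d > 1" "lam \<le> 1" "lam > 0"
  shows "G_tilde b \<alpha> d lam \<ge> 1 / real b powr (real \<alpha> * lam * (2 * real d - 1) / 2)"
proof -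
  let ?X = "(real b - 1) / (real b ^ min \<alpha> d - real b)"
  have "real b ^ 1 < real b ^ min \<alpha> d"
    using assms by (intro power_strict_increasing) auto
  then have pos: "real b ^ min \<alpha> d - real b > 0"
    by simp
  \<comment> \<open>Here \<open>d \<ge> 2\<close> enters, through
    \<open>d - 1 \<ge> 1\<close>.\<close>
  have "min \<alpha> d * 1 \<le> \<alpha> * (d - 1)"
    using assms by (intro mult_mono) auto
  then have "real b ^ min \<alpha> d \<le> real b ^ (\<alpha> * (d - 1))"
    using assms by (intro power_increasing) auto
  also have "\<dots> \<le> real b ^ (\<alpha> * (d - 1)) * (real b - 1)"
    using assms by (intro mult_right_mono[of 1, simplified mult_1] mult_le_cancel_left1[THEN iffD2]) auto
  finally have "1 \<le> real b ^ (\<alpha> * (d - 1)) * ?X"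
    using pos by (simp add: pos_le_divide_eq)
  also have "real b ^ (\<alpha> * (d - 1)) = real b powr (real \<alpha> * (real d - 1))"
    using assms by (simp add: powr_realpow[symmetric] of_nat_diff)
  finally have "1 \<le> (real b powr (real \<alpha> * (real d - 1)) * ?X) powr lam"
    using assms by (intro ge_one_powr_ge_zero) auto
  also have "\<dots> = real b powr (real \<alpha> * (real d - 1) * lam) * ?X powr lam"
    using pos assms by (subst powr_mult) (auto simp: powr_powr)
  also have "real b powr (real \<alpha> * (real d - 1) * lam) =
      real b powr (real \<alpha> * lam * (2 * real d - 1) / 2) / real b powr (real \<alpha> * lam / 2)"
    unfolding powr_diff[symmetric]
    by (rule arg_cong[where f = "\<lambda>t. real b powr t"]) (simp add: field_simps)
  finally have "1 / real b powr (real \<alpha> * lam * (2 * real d - 1) / 2) \<le>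
      1 / real b powr (real \<alpha> * lam / 2) * ?X powr lam"
    using assms by (simp add: field_simps)
  also have "\<dots> \<le> G_tilde b \<alpha> d lam"
    unfolding G_tilde_def by (intro mult_left_mono) auto
  finally show ?thesis .
qed

text \<open>Bernoulli's inequality gives \<open>G_const \<ge> d * G_tilde\<close>, and
  \<open>d \<ge> 2 \<ge> 2 powr lam\<close> supplies the numerator.\<close>

lemma G_const_ge:
  assumes "b \<ge> 2" "min \<alpha> d > 1" "lam \<le> 1" "lam > 0"
  shows "G_const b \<alpha> d lam \<ge> 2 powr lam / real b powr (real \<alpha> * lam * (2 * real d - 1) / 2)"
proof -
  let ?P = "real b powr (real \<alpha> * lam * (2 * real d - 1) / 2)"
  have "2 powr lam \<le> 2 powr (1::real)"
    using assms by (intro powr_mono) auto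
  then have "2 powr lam / ?P \<le> real d * (1 / ?P)"
    using assms by (simp add: divide_right_mono)
  also have "\<dots> \<le> real d * G_tilde b \<alpha> d lam"
    using G_tilde_ge[OF assms] by (intro mult_left_mono) auto
  also have "\<dots> \<le> G_const b \<alpha> d lam"
    using Bernoulli_inequality[of "G_tilde b \<alpha> d lam" d] G_tilde_ge[OF assms]
    unfolding G_const_def by (smt (verit) divide_nonneg_nonneg powr_ge_zero)
  finally show ?thesis .
qed

text \<open>The \<open>lam\<close>-th power of the factor in \<open>gamma_tilde\<close> is
  \<open>?P ^ card v\<close>, where \<open>?P\<close> is the denominator in
  \<open>G_const_ge\<close>. After cancellation each coordinate of \<open>v\<close> still provides
  \<open>2 powr lam\<close>.\<close>

lemma weight_powr_le:
  assumes "b \<ge> 2" "min \<alpha> d > 1" "lam \<le> 1" "lam > 0" "\<gamma> v \<ge> 0"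
  shows "(\<gamma> v * 2 ^ card v) powr lam \<le> gamma_tilde b \<alpha> d \<gamma> v powr lam * G_const b \<alpha> d lam ^ card v"
proof -
  let ?P = "real b powr (real \<alpha> * lam * (2 * real d - 1) / 2)"
  have "(\<gamma> v * 2 ^ card v) powr lam = \<gamma> v powr lam * (2 powr lam) ^ card v"
    using assms by (simp add: powr_mult powr_realpow[symmetric] powr_powr mult.commute)
  also have "\<dots> \<le> \<gamma> v powr lam * (?P * G_const b \<alpha> d lam) ^ card v"
    using G_const_ge[OF assms(1-4)] assms
    by (intro mult_left_mono power_mono) (auto simp: field_simps)
  also have "\<dots> = (\<gamma> v powr lam * ?P ^ card v) * G_const b \<alpha> d lam ^ card v"
    by (simp add: power_mult_distrib)
  also have "?P ^ card v = (real b powr (real \<alpha> * (2 * real d - 1) * real (card v) / 2)) powr lam"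
    using assms by (simp add: powr_realpow[symmetric] powr_powr mult_ac)
  also have "\<gamma> v powr lam * \<dots> = gamma_tilde b \<alpha> d \<gamma> v powr lam"
    using assms by (simp add: gamma_tilde_def powr_mult)
  finally show ?thesis .
qed

section \<open>From the limsup to bounds valid in every dimension\<close>

text \<open>Write \<open>w a\<close> as \<open>w a powr lam\<close> times a power of itself with
  exponent \<open>1 / lam - 1\<close>. This exponent is nonnegative, so the second factor grows when
  \<open>w a powr lam\<close> is replaced by the whole sum \<open>?T\<close>.\<close>

lemma sum_le_powr_sum_powr:
  fixes w :: "'a \<Rightarrow> real"
  assumes "finite A" "\<And>a. a \<in> A \<Longrightarrow> w a \<ge> 0" "0 < lam" "lam \<le> 1"
  shows "(\<Sum>a\<in>A. w a) \<le> (\<Sum>a\<in>A. w a powr lam) powr (1 / lam)"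
proof -
  let ?T = "\<Sum>a\<in>A. w a powr lam"
  have "w a \<le> w a powr lam * ?T powr (1 / lam - 1)" if "a \<in> A" for a
  proof -
    have "w a = w a powr lam * (w a powr lam) powr (1 / lam - 1)"
      using assms that by (simp add: powr_powr powr_add[symmetric] field_simps)
    also have "\<dots> \<le> w a powr lam * ?T powr (1 / lam - 1)"
      using assms that
      by (intro mult_left_mono powr_mono2 member_le_sum) (auto simp: field_simps)
    finally show ?thesis .
  qed
  then have "(\<Sum>a\<in>A. w a) \<le> (\<Sum>a\<in>A. w a powr lam * ?T powr (1 / lam - 1))"
    by (rule sum_mono)
  also have "\<dots> = ?T * ?T powr (1 / lam - 1)"
    by (simp add: sum_distrib_right)
  also have "\<dots> = ?T powr (1 / lam)"
    using sum_nonneg[of A "\<lambda>a. w a powr lam"] by (simp add: powr_mult_base)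
  finally show ?thesis .
qed

text \<open>The limsup controls only a tail; the finitely many earlier terms are absorbed into the
  constant.\<close>

lemma bounded_of_limsup_less_PInfty:
  fixes X :: "nat \<Rightarrow> real"
  assumes "limsup (\<lambda>n. ereal (X n)) < \<infinity>"
  obtains C where "C \<ge> 0" "\<And>n. X n \<le> C"
proof -
  obtain c where "limsup (\<lambda>n. ereal (X n)) < ereal c"
    using assms ereal_dense2 by blast
  then have "eventually (\<lambda>n. X n < c) sequentially"
    using Limsup_lessD by fastforce
  then obtain N where N: "\<And>n. n \<ge> N \<Longrightarrow> X n < c"
    by (auto simp: eventually_sequentially)
  show ?thesis
  proof
    show "\<bar>c\<bar> + (\<Sum>n<N. \<bar>X n\<bar>) \<ge> 0"
      by (intro add_nonneg_nonneg sum_nonneg) auto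
    fix n
    show "X n \<le> \<bar>c\<bar> + (\<Sum>n<N. \<bar>X n\<bar>)"
    proof (cases "n < N")
      case True
      then have "\<bar>X n\<bar> \<le> (\<Sum>n<N. \<bar>X n\<bar>)"
        by (intro member_le_sum) auto
      then show ?thesis by linarith
    next
      case False
      then have "X n \<le> \<bar>c\<bar>"
        using N[of n] by linarith
      then show ?thesis
        by (simp add: add_increasing2 sum_nonneg)
    qed
  qed
qed

text \<open>Covers both claims at once: \<open>e = 0\<close> yields a constant bound and
  \<open>e > 0\<close> a polynomial one of degree \<open>e / lam\<close>.\<close>

lemma worst_case_error_le_powr:
  fixes \<gamma> :: "nat set \<Rightarrow> real"
    and q :: "nat \<Rightarrow> nat \<Rightarrow> 'b::prime_card mod_ring poly"
    and p :: "nat \<Rightarrow> 'b mod_ring poly"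
  assumes b: "b = CARD('b)"
    and \<alpha>d: "min \<alpha> d > 1"
    and \<gamma>: "\<And>v. finite v \<Longrightarrow> v \<subseteq> {1..} \<Longrightarrow> \<gamma> v \<ge> 0"
    and lam: "0 < lam" "lam \<le> 1"
    and A: "A_limsup b \<alpha> d \<gamma> lam e < \<infinity>"
  obtains C where "C \<ge> 0" "\<And>s. s \<ge> 1 \<Longrightarrow>
    worst_case_error b s \<alpha> \<gamma> (b ^ m) (interlaced_lattice_point m d s (q s) (p s))
      \<le> ennreal (C * real s powr (e / lam))"
proof -
  let ?S = "\<lambda>s. \<Sum>v \<in> Pow {1..s} - {{}}. gamma_tilde b \<alpha> d \<gamma> v powr lam * G_const b \<alpha> d lam ^ card v"
  have b2: "b \<ge> 2"
    using prime_card[where 'a = 'b] by (simp add: b prime_ge_2_nat)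
  have \<gamma>': "\<gamma> v \<ge> 0" if "v \<subseteq> {1..s}" for v s
    using that by (intro \<gamma>) (auto intro: finite_subset)
  obtain C where C: "C \<ge> 0" "\<And>s. 1 / real s powr e * ?S s \<le> C"
    using bounded_of_limsup_less_PInfty[OF A[unfolded A_limsup_def]] by blast
  show ?thesis
  proof
    show "C powr (1 / lam) \<ge> 0" by simp
    fix s :: nat assume s: "s \<ge> 1"
    let ?T = "\<Sum>v\<in>Pow {1..s} - {{}}. (\<gamma> v * 2 ^ card v) powr lam"
    have "?T \<le> ?S s"
      using b2 \<alpha>d lam \<gamma>' by (intro sum_mono weight_powr_le) auto
    \<comment> \<open>Multiplying out requires \<open>real s powr e > 0\<close>, hence
      \<open>s \<ge> 1\<close>.\<close>
    also have "\<dots> \<le> C * real s powr e"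
      using C(2)[of s] s by (simp add: field_simps)
    finally have T: "?T \<le> C * real s powr e" .
    have "(\<Sum>v\<in>Pow {1..s} - {{}}. \<gamma> v * 2 ^ card v) \<le> ?T powr (1 / lam)"
      using lam \<gamma>' by (intro sum_le_powr_sum_powr) auto
    also have "\<dots> \<le> (C * real s powr e) powr (1 / lam)"
      using T lam by (intro powr_mono2) (auto intro: sum_nonneg)
    also have "\<dots> = C powr (1 / lam) * real s powr (e / lam)"
      using C by (simp add: powr_mult powr_powr)
    finally have "ennreal (\<Sum>v\<in>Pow {1..s} - {{}}. \<gamma> v * 2 ^ card v)
        \<le> ennreal (C powr (1 / lam) * real s powr (e / lam))"
      by (rule ennreal_leI)
    moreover have "worst_case_error b s \<alpha> \<gamma> (b ^ m) (interlaced_lattice_point m d s (q s) (p s))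
        \<le> ennreal (\<Sum>v\<in>Pow {1..s} - {{}}. \<gamma> v * 2 ^ card v)"
      using b2 \<alpha>d \<gamma>' by (intro worst_case_error_le interlaced_lattice_point_in_cube) auto
    ultimately show "worst_case_error b s \<alpha> \<gamma> (b ^ m) (interlaced_lattice_point m d s (q s) (p s))
        \<le> ennreal (C powr (1 / lam) * real s powr (e / lam))"
      by (rule order_trans[rotated])
  qed
qed

theorem corollary4:
  fixes b m \<alpha> d :: nat
    and \<gamma> :: "nat set \<Rightarrow> real"
    and q :: "nat \<Rightarrow> nat \<Rightarrow> 'b::prime_card mod_ring poly"
    and p :: "nat \<Rightarrow> 'b mod_ring poly"
  assumes b: "b = CARD('b)"
    and m: "m \<ge> 1"
    and \<alpha>d: "min \<alpha> d > 1"
    and \<gamma>: "\<And>v. finite v \<Longrightarrow> v \<subseteq> {1..} \<Longrightarrow> \<gamma> v \<ge> 0"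
    and cbc: "\<And>s. s \<ge> 1 \<Longrightarrow> cbc_constructed \<alpha> d \<gamma> m s (q s) (p s)"
  shows
    "((\<exists>lam. 1 / real (min \<alpha> d) < lam \<and> lam \<le> 1 \<and> A_limsup b \<alpha> d \<gamma> lam 0 < \<infinity>) \<longrightarrow>
       (\<exists>C::real. C \<ge> 0 \<and> (\<forall>s\<ge>1.
          worst_case_error b s \<alpha> \<gamma> (b ^ m) (interlaced_lattice_point m d s (q s) (p s))
            \<le> ennreal C)))
     \<and>
     ((\<exists>lam e. 1 / real (min \<alpha> d) < lam \<and> lam \<le> 1 \<and> e > 0 \<and> A_limsup b \<alpha> d \<gamma> lam e < \<infinity>) \<longrightarrow>
       (\<exists>C \<beta>::real. C \<ge> 0 \<and> \<beta> \<ge> 0 \<and> (\<forall>s\<ge>1.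
          worst_case_error b s \<alpha> \<gamma> (b ^ m) (interlaced_lattice_point m d s (q s) (p s))
            \<le> ennreal (C * real s powr \<beta>))))"
proof (intro conjI impI; elim exE conjE)
  fix lam :: real
  assume lam: "1 / real (min \<alpha> d) < lam" "lam \<le> 1" and A: "A_limsup b \<alpha> d \<gamma> lam 0 < \<infinity>"
  have "lam > 0"
    using lam(1) by (smt (verit) divide_nonneg_nonneg of_nat_0_le_iff)
  then obtain C where C: "C \<ge> 0" "\<And>s. s \<ge> 1 \<Longrightarrow>
      worst_case_error b s \<alpha> \<gamma> (b ^ m) (interlaced_lattice_point m d s (q s) (p s))
        \<le> ennreal (C * real s powr (0 / lam))"
    using worst_case_error_le_powr[OF b \<alpha>d \<gamma> _ lam(2) A, where q = q and p = p and m = m] by blast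
  then show "\<exists>C\<ge>0. \<forall>s\<ge>1.
      worst_case_error b s \<alpha> \<gamma> (b ^ m) (interlaced_lattice_point m d s (q s) (p s)) \<le> ennreal C"
    \<comment> \<open>For \<open>s \<ge> 1\<close> the factor \<open>real s powr 0\<close> is 1; at
      \<open>s = 0\<close> it would be 0.\<close>
    by (intro exI[of _ C]) auto
next
  fix lam e :: real
  assume lam: "1 / real (min \<alpha> d) < lam" "lam \<le> 1" and e: "e > 0"
    and A: "A_limsup b \<alpha> d \<gamma> lam e < \<infinity>"
  have "lam > 0"
    using lam(1) by (smt (verit) divide_nonneg_nonneg of_nat_0_le_iff)
  then obtain C where C: "C \<ge> 0" "\<And>s. s \<ge> 1 \<Longrightarrow>
      worst_case_error b s \<alpha> \<gamma> (b ^ m) (interlaced_lattice_point m d s (q s) (p s))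
        \<le> ennreal (C * real s powr (e / lam))"
    using worst_case_error_le_powr[OF b \<alpha>d \<gamma> _ lam(2) A, where q = q and p = p and m = m] by blast
  then show "\<exists>C \<beta>. C \<ge> 0 \<and> \<beta> \<ge> 0 \<and> (\<forall>s\<ge>1.
      worst_case_error b s \<alpha> \<gamma> (b ^ m) (interlaced_lattice_point m d s (q s) (p s))
        \<le> ennreal (C * real s powr \<beta>))"
    using e \<open>lam > 0\<close> by (intro exI[of _ C] exI[of _ "e / lam"]) auto
qed

end
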